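(* Let $D>1$ be an integer and let $M_1,\dots,M_L$ be $L$ different $D\times D$ integer matrices, i.e., no two of them only differ by a unimodular matrix factor (for $i\neq l$ there is no unimodular matrix $U$ with $M_i=M_lU$). If their determinant absolute values $|\det(M_1)|,\dots,|\det(M_L)|$ are conventional prime numbers, then $M_1,\dots,M_L$ are pairwise (left) co-prime.
   Context: All matrices are $D\times D$ with entries in $\mathbb{Z}$. A matrix is unimodular if its determinant is $1$ or $-1$. A matrix $A$ and $AU$, with $U$ unimodular, are regarded as the same matrix. By convention $1$ is also counted as a conventional prime integer. A nonsingular integer matrix $C$ is a left divisor of an integer matrix $M$ if $C^{-1}M$ is an integer matrix. A common left divisor (cld) of several matrices is a matrix that is a left divisor of each of them; a greatest common left divisor (gcld) is a cld $A$ such that every other cld is a left divisor of $A$. Two matrices are (left) co-prime if their gcld is unimodular. *)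

theory Defs
  imports "HOL-Analysis.Determinants" "HOL-Computational_Algebra.Primes"
begin

definition unimodular :: "int^'n^'n \<Rightarrow> bool" where
  "unimodular A \<longleftrightarrow> det A = 1 \<or> det A = -1"

definition same_matrix :: "int^'n^'n \<Rightarrow> int^'n^'n \<Rightarrow> bool" where
  "same_matrix A B \<longleftrightarrow> (\<exists>U. unimodular U \<and> A = B ** U)"

text \<open>The inverse of a nonsingular integer matrix is taken over the rationals.\<close>

abbreviation rat_matrix :: "int^'n^'m \<Rightarrow> rat^'n^'m" where
  "rat_matrix \<equiv> map_matrix rat_of_int"

definition left_divisor :: "int^'n^'n \<Rightarrow> int^'n^'n \<Rightarrow> bool" where
  "left_divisor C M \<longleftrightarrow>
     det C \<noteq> 0 \<and> (\<exists>N. matrix_inv (rat_matrix C) ** rat_matrix M = rat_matrix N)"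

definition is_cld :: "int^'n^'n \<Rightarrow> (int^'n^'n) set \<Rightarrow> bool" where
  "is_cld A S \<longleftrightarrow> (\<forall>M\<in>S. left_divisor A M)"

definition is_gcld :: "int^'n^'n \<Rightarrow> (int^'n^'n) set \<Rightarrow> bool" where
  "is_gcld A S \<longleftrightarrow> is_cld A S \<and> (\<forall>B. is_cld B S \<longrightarrow> left_divisor B A)"

text \<open>A gcld is determined only up to a unimodular right factor, and it is not taken for
  granted here that one exists: existence is part of co-primality.\<close>

definition left_coprime :: "int^'n^'n \<Rightarrow> int^'n^'n \<Rightarrow> bool" where
  "left_coprime M N \<longleftrightarrow>
     (\<exists>A. is_gcld A {M, N}) \<and> (\<forall>A. is_gcld A {M, N} \<longrightarrow> unimodular A)"

text \<open>By convention 1 counts as a conventional prime.\<close>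

definition conventional_prime :: "int \<Rightarrow> bool" where
  "conventional_prime p \<longleftrightarrow> p = 1 \<or> prime p"

end

theory Submission
  imports Defs
begin

text \<open>If \<open>A\<close> is a common left divisor of \<open>M i\<close> and \<open>M l\<close>, then \<open>\<bar>det A\<bar>\<close> divides both of their
  determinants. Were it not \<open>1\<close>, it would equal both, so both cofactors would be unimodular, and
  \<open>M i\<close> and \<open>M l\<close> would each differ from \<open>A\<close>, hence from each other, by a unimodular factor. So
  every common left divisor is unimodular, and the identity matrix is a gcld.\<close>

lemma rat_matrix_mult: "rat_matrix (A ** B) = rat_matrix A ** rat_matrix B"
  by (simp add: vec_eq_iff matrix_matrix_mult_def)

lemma rat_matrix_eq_iff: "rat_matrix A = rat_matrix B \<longleftrightarrow> A = B"
  by (simp add: vec_eq_iff)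

lemma det_rat_matrix: "det (rat_matrix A) = of_int (det A)"
  by (simp add: det_def)

lemma unimodular_mult: "unimodular A \<Longrightarrow> unimodular B \<Longrightarrow> unimodular (A ** B)"
  by (auto simp: unimodular_def det_mul)

lemma unimodular_iff_abs: "unimodular A \<longleftrightarrow> \<bar>det A\<bar> = 1"
  by (auto simp: unimodular_def)

lemma matrix_inv_mult:
  assumes "invertible A"
  shows "A ** matrix_inv A = mat 1" "matrix_inv A ** A = mat 1"
proof -
  have "A ** matrix_inv A = mat 1 \<and> matrix_inv A ** A = mat 1"
    unfolding matrix_inv_def using assms[unfolded invertible_def] by (rule someI_ex)
  then show "A ** matrix_inv A = mat 1" "matrix_inv A ** A = mat 1" by simp_all
qed

text \<open>Multiplying by \<open>C\<close> or its rational inverse turns divisibility into a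
  factorization over the integers, the form used from here on.\<close>

lemma left_divisor_iff: "left_divisor C M \<longleftrightarrow> det C \<noteq> 0 \<and> (\<exists>N. M = C ** N)"
proof (cases "det C = 0")
  case False
  then have inv: "invertible (rat_matrix C)"
    by (simp add: invertible_det_nz det_rat_matrix)
  have "matrix_inv (rat_matrix C) ** rat_matrix M = rat_matrix N
      \<longleftrightarrow> rat_matrix M = rat_matrix C ** rat_matrix N" for N
    using matrix_inv_mult[OF inv] by (metis matrix_mul_assoc matrix_mul_lid)
  then show ?thesis
    using False by (simp add: left_divisor_def rat_matrix_eq_iff flip: rat_matrix_mult)
qed (simp add: left_divisor_def)

text \<open>By Cramer's rule the entries of the rational inverse are minors divided by \<open>det A = \<plusminus>1\<close>.\<close>

lemma unimodular_right_inverse: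
  fixes A :: "int^'n^'n"
  assumes "unimodular A"
  obtains B where "unimodular B" "A ** B = mat 1"
proof -
  \<comment> \<open>\<open>R c k\<close> is \<open>A\<close> with column \<open>k\<close> replaced
    by the \<open>c\<close>-th unit vector, as in Cramer's rule.\<close>
  define R where "R c k = (\<chi> i j. if j = k then if i = c then 1 else 0 else A$i$j)" for c k :: 'n
  \<comment> \<open>Since \<open>det A\<close> is its own inverse, multiplying by it replaces
    Cramer's division and keeps \<open>B\<close> integral.\<close>
  define B where "B = (\<chi> k c. det A * det (R c k))"
  have d0: "det (rat_matrix A) \<noteq> 0"
    using assms by (auto simp: unimodular_def det_rat_matrix)
  have col: "rat_matrix A *v (\<chi> k. of_int (B$k$c)) = axis c 1" for c
  proof -
    have "rat_matrix (R c k) = (\<chi> i j. if j = k then axis c 1 $ i else rat_matrix A $ i $ j)" for k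
      by (simp add: vec_eq_iff R_def axis_def)
    moreover have "of_int (B$k$c) = det (rat_matrix (R c k)) / det (rat_matrix A)" for k
      using assms by (auto simp: unimodular_def B_def det_rat_matrix)
    ultimately show ?thesis
      by (simp add: cramer[OF d0])
  qed
  have "rat_matrix (A ** B) $ i $ c = rat_matrix (mat 1) $ i $ c" for i c
    using arg_cong[OF col[of c], of "\<lambda>v. v $ i"]
    by (simp add: matrix_vector_mult_def matrix_matrix_mult_def axis_def mat_def)
  then have "rat_matrix (A ** B) = rat_matrix (mat 1)"
    by (simp add: vec_eq_iff)
  then have AB: "A ** B = mat 1"
    by (simp only: rat_matrix_eq_iff)
  then have "det A * det B = 1"
    by (metis det_I det_mul)
  then have "unimodular B"
    using assms by (auto simp: unimodular_def)
  then show thesis using AB by (rule that)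
qed

text \<open>If \<open>W\<close> inverts \<open>V\<close>, then \<open>W ** U\<close> carries
  \<open>A ** V\<close> to \<open>A ** U\<close>.\<close>

lemma same_matrix_right_factors:
  assumes "unimodular U" "unimodular V"
  shows "same_matrix (A ** U) (A ** V)"
proof -
  obtain W where W: "unimodular W" "V ** W = mat 1"
    using unimodular_right_inverse[OF assms(2)] .
  have "A ** U = A ** V ** (W ** U)"
    by (metis W(2) matrix_mul_assoc matrix_mul_rid)
  then show ?thesis
    using unimodular_mult[OF W(1) assms(1)] by (auto simp: same_matrix_def)
qed

text \<open>Primes are irreducible, so one factor is a unit; a product equal to 1 has only unit
  factors.\<close>

lemma conventional_prime_factor:
  assumes "conventional_prime \<bar>a * b\<bar>"
  shows "\<bar>a\<bar> = 1 \<or> \<bar>b\<bar> = 1"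
  using assms unfolding conventional_prime_def abs_mult
proof
  assume "\<bar>a\<bar> * \<bar>b\<bar> = 1"
  then show ?thesis by (auto simp: zmult_eq_1_iff)
next
  assume "prime (\<bar>a\<bar> * \<bar>b\<bar>)"
  then have "irreducible (\<bar>a\<bar> * \<bar>b\<bar>)"
    by (simp add: prime_elem_imp_irreducible)
  from irreducibleD[OF this refl] show ?thesis by simp
qed

lemma cld_unimodular:
  assumes "conventional_prime \<bar>det M\<bar>" "conventional_prime \<bar>det N\<bar>"
    and "\<not> same_matrix M N" "is_cld A {M, N}"
  shows "unimodular A"
proof (rule ccontr)
  assume A: "\<not> unimodular A"
  obtain U V where UV: "M = A ** U" "N = A ** V"
    using assms(4) by (auto simp: is_cld_def left_divisor_iff)
  \<comment> \<open>In both products \<open>det A * det U\<close> and \<open>det A * det V\<close>,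
    the factor \<open>det A\<close> is not a unit, so the other one is.\<close>
  then have "unimodular U" "unimodular V"
    using A assms(1,2) by (auto simp: det_mul unimodular_iff_abs dest: conventional_prime_factor)
  with same_matrix_right_factors UV assms(3) show False by blast
qed

lemma unimodular_left_divisor:
  assumes "unimodular A"
  shows "left_divisor A M"
proof -
  obtain B where "A ** B = mat 1"
    using unimodular_right_inverse[OF assms] .
  then have "M = A ** (B ** M)"
    by (simp add: matrix_mul_assoc)
  then show ?thesis
    using assms by (auto simp: left_divisor_iff unimodular_def)
qed

theorem corollary2:
  fixes M :: "nat \<Rightarrow> int^'n^'n" and L :: nat
  assumes "CARD('n) > 1"
    and "\<forall>i\<in>{1..L}. \<forall>l\<in>{1..L}. i \<noteq> l \<longrightarrow> \<not> same_matrix (M i) (M l)"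
    and "\<forall>i\<in>{1..L}. conventional_prime \<bar>det (M i)\<bar>"
  shows "\<forall>i\<in>{1..L}. \<forall>l\<in>{1..L}. i \<noteq> l \<longrightarrow> left_coprime (M i) (M l)"
proof (intro ballI impI)
  fix i l assume "i \<in> {1..L}" "l \<in> {1..L}" "i \<noteq> l"
  then have cld: "unimodular A" if "is_cld A {M i, M l}" for A
    using cld_unimodular that assms(2,3) by blast
  have "unimodular (mat 1 :: int^'n^'n)"
    by (simp add: unimodular_def)
  \<comment> \<open>Unimodular matrices divide everything: hence \<open>mat 1\<close> is a cld, and
    every cld, being unimodular by \<open>cld\<close>, divides \<open>mat 1\<close>.\<close>
  then have "is_gcld (mat 1) {M i, M l}"
    by (auto simp: is_gcld_def is_cld_def[of "mat 1"] intro: unimodular_left_divisor cld)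
  with cld show "left_coprime (M i) (M l)"
    by (auto simp: left_coprime_def is_gcld_def)
qed

end
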